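(* Let $K$ be a field of characteristic zero and $\mathbb{I}_1=K\langle x,\partial,\int\rangle$ the algebra of polynomial integro-differential operators in one variable. With the notation of the context: 1. ${}'\mathcal{C}_{\mathbb{I}_1}$ is the set of all $a\in\mathbb{I}_1\setminus\Psi$ such that the map $\cdot a:P'_{1,\le\nu(a)}\to P'_{1,\le\nu(a)+\deg_\partial(a_\partial)}$, $p\mapsto pa$, is an injection. 2. $\mathcal{C}'_{\mathbb{I}_1}=({}'\mathcal{C}_{\mathbb{I}_1})^*$.
   Context: For a ring $R$, ${}'\mathcal{C}_R=\{c\in R\mid rc=0\Rightarrow r=0\}$ is the set of left regular elements and $\mathcal{C}'_R=\{c\in R\mid cr=0\Rightarrow r=0\}$ the set of right regular elements. $\mathbb{I}_1$ is the subalgebra of $\mathrm{End}_K(K[x])$ generated by multiplication by $x$, $\partial=\frac{d}{dx}$ and $\int:x^k\mapsto\frac{x^{k+1}}{k+1}$; $H:=\partial x$. Let $e_{ij}=\int^i\partial^j-\int^{i+1}\partial^{j+1}$ and $F=\bigoplus_{i,j\ge0}Ke_{ij}$ (an ideal of $\mathbb{I}_1$). Then $\mathbb{I}_1=\bigoplus_{i\ge1}K[H]\partial^i\oplus K[H]\oplus\bigoplus_{i\ge1}\int^iK[H]\oplus F$, so each $a\in\mathbb{I}_1$ is a unique sum $a=\sum_{i=0}^ld_{-i}\partial^i+\sum_{j=1}^m\int^jd_j+a_F$ with $d_k\in K[H]$, $a_F\in F$. Put $a_\partial:=\sum_{i=0}^ld_{-i}\partial^i$. The size is $s(a):=\min\{n\in\mathbb{N}\mid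 a_F\in\bigoplus_{i,j=0}^nKe_{ij}\}$ if $a_F\neq0$ and $s(a):=-1$ if $a_F=0$. Put $\Psi:=\bigoplus_{i\ge1}\int^iK[H]\oplus F$. Let $\tau\in\mathrm{Aut}_K(K[H])$, $\tau(H)=H+1$, and $\mathbb{N}_+=\{1,2,\ldots\}$. For $0\ne p\in K[H]$, $\mu(p):=\min\{i\in\mathbb{N}\mid\tau^i(p)\text{ has no root in }\mathbb{N}_+\}$. If $a\in\mathbb{I}_1\setminus\Psi$, then $a_\partial\neq0$; with $n=\deg_\partial(a_\partial)$ (so $d_{-n}\ne0$) put $\mu(a):=\mu(d_{-n})$ and $\nu(a):=\max\{s(a),\mu(a)\}$. $P_1'=K[\partial]$ is the right $\mathbb{I}_1$-module $\mathbb{I}_1/(\int\mathbb{I}_1+(H-1)\mathbb{I}_1)$, with action $\partial^k\cdot\partial=\partial^{k+1}$, $\partial^k\cdot\int=\partial^{k-1}$ for $k\ge1$, $1\cdot\int=0$, $\partial^k\cdot H=(k+1)\partial^k$; $P'_{1,\le i}:=\{p\in P_1'\mid\deg_\partial(p)\le i\}$. The involution $*$ is the $K$-algebra anti-automorphism of $\mathbb{I}_1$ with $\partial^*=\int$, $\int^*=\partial$, $H^*=H$, and $({}'\mathcal{C}_{\mathbb{I}_1})^*=\{c^*\mid c\in{}'\mathcal{C}_{\mathbb{I}_1}\}$. *)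

theory Defs
  imports "HOL-Computational_Algebra.Polynomial" "HOL-Library.FuncSet"
begin

section \<open>Regular elements of a ring\<close>

text \<open>The sides follow the source: \<open>c\<close> is \<^emph>\<open>left\<close> regular when \<open>r * c = 0\<close> forces \<open>r = 0\<close>.\<close>

definition left_regular_elements :: "'r::ring set" where
  "left_regular_elements = {c. \<forall>r. r * c = 0 \<longrightarrow> r = 0}"

definition right_regular_elements :: "'r::ring set" where
  "right_regular_elements = {c. \<forall>r. c * r = 0 \<longrightarrow> r = 0}"


section \<open>The algebra of polynomial integro-differential operators\<close>

definition pint :: "'k::field_char_0 poly \<Rightarrow> 'k poly" where
  "pint p = (\<Sum>k\<le>degree p. monom (coeff p k / of_nat (k + 1)) (k + 1))"

lemma coeff_pint: "coeff (pint p) n = (case n of 0 \<Rightarrow> 0 | Suc k \<Rightarrow> coeff p k / of_nat (k + 1))"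
  by (cases n) (auto simp: pint_def coeff_sum if_distrib coeff_eq_0 not_le cong: if_cong)

lemma pint_monom: "pint (monom 1 k) = monom (1 / of_nat (k + 1)) (k + 1)"
  by (rule poly_eqI) (auto simp: coeff_pint split: nat.splits)

lemma pint_add: "pint (p + q) = pint p + pint q"
  by (rule poly_eqI) (auto simp: coeff_pint add_divide_distrib split: nat.splits)

lemma pint_smult: "pint (smult c p) = smult c (pint p)"
  by (rule poly_eqI) (auto simp: coeff_pint split: nat.splits)

lemma pderiv_pint: "pderiv (pint p) = p"
  by (rule poly_eqI) (simp add: coeff_pderiv coeff_pint del: of_nat_Suc)

text \<open>The unital \<open>K\<close>-subalgebra of \<open>End\<^sub>K(K[x])\<close> generated by \<open>x\<close>, \<open>\<partial>\<close> and \<open>\<integral>\<close>, with composition as product.\<close>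

inductive_set intdiff_ops :: "('k::field_char_0 poly \<Rightarrow> 'k poly) set" where
  gen_x: "(\<lambda>p. [:0, 1:] * p) \<in> intdiff_ops"
| gen_deriv: "pderiv \<in> intdiff_ops"
| gen_int: "pint \<in> intdiff_ops"
| one: "id \<in> intdiff_ops"
| add: "f \<in> intdiff_ops \<Longrightarrow> g \<in> intdiff_ops \<Longrightarrow> (\<lambda>p. f p + g p) \<in> intdiff_ops"
| scale: "f \<in> intdiff_ops \<Longrightarrow> (\<lambda>p. smult c (f p)) \<in> intdiff_ops"
| comp: "f \<in> intdiff_ops \<Longrightarrow> g \<in> intdiff_ops \<Longrightarrow> f \<circ> g \<in> intdiff_ops"

lemma intdiff_ops_linear:
  assumes "f \<in> intdiff_ops"
  shows "f (p + q) = f p + f q" and "f (smult c p) = smult c (f p)"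
proof -
  have "(\<forall>p q. f (p + q) = f p + f q) \<and> (\<forall>c p. f (smult c p) = smult c (f p))"
    using assms
    by induction (auto simp: algebra_simps smult_add_right pderiv_add pderiv_smult pint_add pint_smult)
  then show "f (p + q) = f p + f q" "f (smult c p) = smult c (f p)" by auto
qed

typedef (overloaded) 'k intdiff = "intdiff_ops :: ('k::field_char_0 poly \<Rightarrow> 'k poly) set"
  by (rule exI[of _ id]) (rule intdiff_ops.one)

setup_lifting type_definition_intdiff

instantiation intdiff :: (field_char_0) ring_1
begin

lift_definition zero_intdiff :: "'a intdiff" is "\<lambda>_. 0"
  using intdiff_ops.scale[OF intdiff_ops.one, of 0] by simp

lift_definition one_intdiff :: "'a intdiff" is id
  by (rule intdiff_ops.one)

lift_definition plus_intdiff :: "'a intdiff \<Rightarrow> 'a intdiff \<Rightarrow> 'a intdiff" is "\<lambda>f g p. f p + g p"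
  by (rule intdiff_ops.add)

lift_definition uminus_intdiff :: "'a intdiff \<Rightarrow> 'a intdiff" is "\<lambda>f p. - f p"
  using intdiff_ops.scale[of _ "- 1"] by simp

lift_definition minus_intdiff :: "'a intdiff \<Rightarrow> 'a intdiff \<Rightarrow> 'a intdiff" is "\<lambda>f g p. f p - g p"
proof -
  fix f g :: "'a poly \<Rightarrow> 'a poly"
  assume "f \<in> intdiff_ops" "g \<in> intdiff_ops"
  then show "(\<lambda>p. f p - g p) \<in> intdiff_ops"
    using intdiff_ops.add[of f "\<lambda>p. smult (- 1) (g p)"] intdiff_ops.scale[of g "- 1"] by simp
qed

lift_definition times_intdiff :: "'a intdiff \<Rightarrow> 'a intdiff \<Rightarrow> 'a intdiff" is "(\<circ>)"
  by (rule intdiff_ops.comp)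

instance
proof
  show "(0 :: 'a intdiff) \<noteq> 1"
    by transfer (metis id_apply zero_neq_one)
qed (transfer; auto simp: fun_eq_iff intdiff_ops_linear algebra_simps)+

end

lift_definition scl :: "'k::field_char_0 \<Rightarrow> 'k intdiff \<Rightarrow> 'k intdiff" is "\<lambda>c f p. smult c (f p)"
  by (rule intdiff_ops.scale)

interpretation intdiff: vector_space scl
  by unfold_locales (transfer; auto simp: fun_eq_iff smult_add_left smult_add_right)+

lemma scl_mult_left: "scl c a * b = scl c (a * b)"
  by transfer auto

lemma scl_mult_right: "a * scl c b = scl c (a * b)"
  by transfer (auto simp: intdiff_ops_linear)

lift_definition opX :: "'k::field_char_0 intdiff" is "\<lambda>p. [:0, 1:] * p" by (rule intdiff_ops.gen_x)
lift_definition opD :: "'k::field_char_0 intdiff" is pderiv by (rule intdiff_ops.gen_deriv)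
lift_definition opI :: "'k::field_char_0 intdiff" is pint by (rule intdiff_ops.gen_int)

definition opH :: "'k::field_char_0 intdiff" where
  "opH = opD * opX"

lemma opD_opI: "opD * opI = 1"
  by transfer (auto simp: pderiv_pint)

lemma opX_eq: "opX = opI * opH"
  unfolding opH_def
  by transfer (auto simp: fun_eq_iff coeff_pint coeff_pderiv poly_eq_iff coeff_pCons
      simp del: of_nat_Suc split: nat.splits)

lemma opH_eq: "opH = 1 + opX * opD"
  unfolding opH_def by transfer (auto simp: fun_eq_iff pderiv_pCons)

lemma opD_opH: "opD * opH = (opH + 1) * opD"
  by (simp add: opH_eq distrib_left distrib_right mult.assoc flip: opH_def)
    (simp add: opH_eq distrib_right add.assoc flip: mult.assoc opH_def)


section \<open>Canonical form, size and the invariants of an operator\<close>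

text \<open>An element \<open>d\<close> of \<open>K[H]\<close> is represented by the polynomial whose value at \<open>H\<close> it is.\<close>

definition atH :: "'k::field_char_0 poly \<Rightarrow> 'k intdiff" where
  "atH d = (\<Sum>i\<le>degree d. scl (coeff d i) (opH ^ i))"

definition opE :: "nat \<Rightarrow> nat \<Rightarrow> 'k::field_char_0 intdiff" where
  "opE i j = opI ^ i * opD ^ j - opI ^ (i + 1) * opD ^ (j + 1)"

definition idealF :: "'k::field_char_0 intdiff set" where
  "idealF = intdiff.span {opE i j | i j. True}"

definition Psi :: "'k::field_char_0 intdiff set" where
  "Psi = {(\<Sum>j = 1..m. opI ^ j * atH (d j)) + f | m d f. f \<in> idealF}"

text \<open>\<open>canonical_form a d f\<close>: \<open>a\<close> is the sum of the \<open>d\<^sub>-\<^sub>i \<partial>\<^sup>i\<close> for \<open>i \<ge> 0\<close>, the \<open>\<integral>\<^sup>j d\<^sub>j\<close> for \<open>j \<ge> 1\<close>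
  and \<open>f \<in> F\<close>. The family \<open>d\<close> is extended by zero outside of \<open>{- l..m}\<close>, so that it
  does not depend on the choice of the bounds.\<close>

definition canonical_form :: "'k::field_char_0 intdiff \<Rightarrow> (int \<Rightarrow> 'k poly) \<Rightarrow> 'k intdiff \<Rightarrow> bool" where
  "canonical_form a d f \<longleftrightarrow> f \<in> idealF \<and>
     (\<exists>l m :: nat. (\<forall>k. k < - int l \<or> int m < k \<longrightarrow> d k = 0) \<and>
        a = (\<Sum>i = 0..l. atH (d (- int i)) * opD ^ i) + (\<Sum>j = 1..m. opI ^ j * atH (d (int j))) + f)"

definition dcoeff :: "'k::field_char_0 intdiff \<Rightarrow> int \<Rightarrow> 'k poly" where
  "dcoeff a = (THE d. \<exists>f. canonical_form a d f)"

definition F_part :: "'k::field_char_0 intdiff \<Rightarrow> 'k intdiff" where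
  "F_part a = (THE f. \<exists>d. canonical_form a d f)"

definition D_part :: "'k::field_char_0 intdiff \<Rightarrow> 'k intdiff" where
  "D_part a = (\<Sum>i | dcoeff a (- int i) \<noteq> 0. atH (dcoeff a (- int i)) * opD ^ i)"

text \<open>Only meaningful for nonzero \<open>u\<close> of the form \<open>D_part a\<close>.\<close>

definition deg_D :: "'k::field_char_0 intdiff \<Rightarrow> nat" where
  "deg_D u = Max {i. dcoeff u (- int i) \<noteq> 0}"

definition op_size :: "'k::field_char_0 intdiff \<Rightarrow> int" where
  "op_size a = (if F_part a = 0 then - 1
     else int (LEAST n. F_part a \<in> intdiff.span {opE i j | i j. i \<le> n \<and> j \<le> n}))"

definition tau :: "'k::field_char_0 poly \<Rightarrow> 'k poly" where
  "tau p = pcompose p [:1, 1:]"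

definition mu_poly :: "'k::field_char_0 poly \<Rightarrow> nat" where
  "mu_poly p = (LEAST i. \<forall>k\<ge>1. poly ((tau ^^ i) p) (of_nat k) \<noteq> 0)"

definition mu :: "'k::field_char_0 intdiff \<Rightarrow> nat" where
  "mu a = mu_poly (dcoeff a (- int (deg_D (D_part a))))"

text \<open>The maximum is nonnegative, so the conversion to \<open>nat\<close> does not truncate.\<close>

definition nu :: "'k::field_char_0 intdiff \<Rightarrow> nat" where
  "nu a = nat (max (op_size a) (int (mu a)))"


section \<open>The right module \<open>K[\<partial>]\<close>\<close>

lifting_forget intdiff.lifting

definition ideal_P1 :: "'k::field_char_0 intdiff set" where
  "ideal_P1 = {opI * u + (opH - 1) * v | u v. True}"

lemma ideal_P1_0: "0 \<in> ideal_P1"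
  unfolding ideal_P1_def by (intro CollectI exI[of _ 0]) simp

lemma ideal_P1_add: "a \<in> ideal_P1 \<Longrightarrow> b \<in> ideal_P1 \<Longrightarrow> a + b \<in> ideal_P1"
proof -
  assume "a \<in> ideal_P1" "b \<in> ideal_P1"
  then obtain u v u' v' where "a = opI * u + (opH - 1) * v" "b = opI * u' + (opH - 1) * v'"
    unfolding ideal_P1_def by blast
  then have "a + b = opI * (u + u') + (opH - 1) * (v + v')"
    by (simp only: distrib_left add.assoc add.left_commute)
  then show ?thesis unfolding ideal_P1_def by blast
qed

lemma ideal_P1_mult: "a \<in> ideal_P1 \<Longrightarrow> a * b \<in> ideal_P1"
proof -
  assume "a \<in> ideal_P1"
  then obtain u v where "a = opI * u + (opH - 1) * v"
    unfolding ideal_P1_def by blast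
  then have "a * b = opI * (u * b) + (opH - 1) * (v * b)"
    by (simp add: distrib_right mult.assoc)
  then show ?thesis unfolding ideal_P1_def by blast
qed

lemma ideal_P1_minus: "a \<in> ideal_P1 \<Longrightarrow> - a \<in> ideal_P1"
  using ideal_P1_mult[of a "- 1"] by simp

quotient_type (overloaded) 'k P1 = "'k::field_char_0 intdiff" / "\<lambda>u v. u - v \<in> ideal_P1"
proof (rule equivpI)
  show "reflp (\<lambda>u v :: 'k intdiff. u - v \<in> ideal_P1)"
    by (auto intro!: reflpI simp: ideal_P1_0)
  show "symp (\<lambda>u v :: 'k intdiff. u - v \<in> ideal_P1)"
    by (intro sympI) (metis ideal_P1_minus minus_diff_eq)
  show "transp (\<lambda>u v :: 'k intdiff. u - v \<in> ideal_P1)"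
    by (intro transpI) (metis ideal_P1_add diff_add_cancel add_diff_eq)
qed

instantiation P1 :: (field_char_0) ab_group_add
begin

lift_definition zero_P1 :: "'a P1" is 0 .

lift_definition plus_P1 :: "'a P1 \<Rightarrow> 'a P1 \<Rightarrow> 'a P1" is "(+)"
  by (metis ideal_P1_add add_diff_add)

lift_definition uminus_P1 :: "'a P1 \<Rightarrow> 'a P1" is uminus
  by (metis ideal_P1_minus minus_diff_minus)

lift_definition minus_P1 :: "'a P1 \<Rightarrow> 'a P1 \<Rightarrow> 'a P1" is "(-)"
proof -
  fix a b c d :: "'a intdiff"
  assume "a - b \<in> ideal_P1" "c - d \<in> ideal_P1"
  then have "(a - b) + - (c - d) \<in> ideal_P1"
    by (intro ideal_P1_add ideal_P1_minus)
  then show "(a - c) - (b - d) \<in> ideal_P1"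
    by (simp add: algebra_simps)
qed

instance
  by standard (transfer; simp add: ideal_P1_0 algebra_simps)+

end

text \<open>The class in \<open>P1\<close> of an operator; the element \<open>\<partial>\<^sup>k\<close> of \<open>K[\<partial>]\<close> is the class of \<open>opD ^ k\<close>.\<close>

lift_definition P1_class :: "'k::field_char_0 intdiff \<Rightarrow> 'k P1" is "\<lambda>u. u" .

lift_definition P1_act :: "'k::field_char_0 P1 \<Rightarrow> 'k intdiff \<Rightarrow> 'k P1" is "(*)"
  by (metis ideal_P1_mult left_diff_distrib)

lemma P1_act_module:
  "P1_act p 1 = p"
  "P1_act p (a * b) = P1_act (P1_act p a) b"
  "P1_act p (a + b) = P1_act p a + P1_act p b"
  "P1_act (p + q) a = P1_act p a + P1_act q a"
  by (transfer; simp add: ideal_P1_0 algebra_simps)+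

lemma P1_act_table:
  shows "P1_act (P1_class (opD ^ k :: 'k::field_char_0 intdiff)) opD = P1_class (opD ^ (k + 1))"
    and "k \<ge> 1 \<Longrightarrow> P1_act (P1_class (opD ^ k :: 'k intdiff)) opI = P1_class (opD ^ (k - 1))"
    and "P1_act (P1_class (1 :: 'k intdiff)) opI = 0"
    and "P1_act (P1_class (opD ^ k :: 'k intdiff)) opH = P1_class (scl (of_nat (k + 1)) (opD ^ k))"
proof -
  show "P1_act (P1_class (opD ^ k :: 'k intdiff)) opD = P1_class (opD ^ (k + 1))"
    by transfer (simp add: ideal_P1_0 power_commutes)
  show "k \<ge> 1 \<Longrightarrow> P1_act (P1_class (opD ^ k :: 'k intdiff)) opI = P1_class (opD ^ (k - 1))"
  proof -
    assume "k \<ge> 1"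
    then have "opD ^ k * opI = (opD ^ (k - 1) :: 'k intdiff)"
      using power_Suc2[of "opD :: 'k intdiff" "k - 1"] by (simp add: mult.assoc opD_opI)
    then show ?thesis by transfer (simp add: ideal_P1_0)
  qed
  show "P1_act (P1_class (1 :: 'k intdiff)) opI = 0"
    by transfer (simp add: ideal_P1_def, rule exI[of _ 1], rule exI[of _ 0], simp)
  have "opD ^ k * opH = (opH + of_nat k) * (opD ^ k :: 'k intdiff)"
  proof (induction k)
    case (Suc k)
    have "opD ^ Suc k * opH = opD * (opH + of_nat k) * (opD ^ k :: 'k intdiff)"
      by (simp add: Suc.IH mult.assoc)
    also have "opD * (opH + of_nat k) = (opH + 1 + of_nat k) * (opD :: 'k intdiff)"
      by (simp only: distrib_left distrib_right opD_opH mult_of_nat_commute)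
    finally show ?case
      by (simp add: mult.assoc add.assoc)
  qed simp
  moreover have "of_nat n = scl (of_nat n) (1 :: 'k intdiff)" for n
    by (induction n) (simp_all add: intdiff.scale_left_distrib)
  ultimately have "opD ^ k * opH - scl (of_nat (k + 1)) (opD ^ k) =
      (opH + of_nat k) * (opD ^ k) - of_nat (k + 1) * (opD ^ k :: 'k intdiff)"
    by (metis scl_mult_left mult_1)
  also have "\<dots> = opI * 0 + (opH - 1) * (opD ^ k :: 'k intdiff)"
    by (simp add: algebra_simps)
  finally have "opD ^ k * opH - scl (of_nat (k + 1)) (opD ^ k) =
      opI * 0 + (opH - 1) * (opD ^ k :: 'k intdiff)" .
  then show "P1_act (P1_class (opD ^ k :: 'k intdiff)) opH = P1_class (scl (of_nat (k + 1)) (opD ^ k :: 'k intdiff))"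
    unfolding ideal_P1_def by transfer (metis (mono_tags, lifting) ideal_P1_def mem_Collect_eq)
qed

definition P1_le :: "nat \<Rightarrow> 'k::field_char_0 P1 set" where
  "P1_le i = {P1_class (\<Sum>k\<le>i. scl (c k) (opD ^ k)) | c. True}"


section \<open>The involution\<close>

definition anti_automorphism :: "('k::field_char_0 intdiff \<Rightarrow> 'k intdiff) \<Rightarrow> bool" where
  "anti_automorphism \<phi> \<longleftrightarrow> bij \<phi> \<and> \<phi> 1 = 1 \<and> (\<forall>a b. \<phi> (a + b) = \<phi> a + \<phi> b) \<and>
     (\<forall>c a. \<phi> (scl c a) = scl c (\<phi> a)) \<and> (\<forall>a b. \<phi> (a * b) = \<phi> b * \<phi> a)"

definition invol :: "'k::field_char_0 intdiff \<Rightarrow> 'k intdiff" where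
  "invol = (THE \<phi>. anti_automorphism \<phi> \<and> \<phi> opD = opI \<and> \<phi> opI = opD \<and> \<phi> opH = opH)"

end

theory Submission
  imports Defs
begin

text \<open>In the basis \<open>x\<^sup>k / k!\<close> of \<open>K[x]\<close>, the elements of \<open>I\<^sub>1\<close> are exactly the infinite matrices
  that, outside of a finite block, have on the diagonal \<open>i - j = k\<close> the entries
  \<open>d\<^sub>k(min i j + 1)\<close> with finitely many nonzero polynomials \<open>d\<^sub>k\<close>; these polynomials and the
  block are the canonical form. This description is symmetric in \<open>i\<close> and \<open>j\<close>, so transposition
  is the involution. The module \<open>P\<^sub>1'\<close> consists of the finitely supported rows, and \<open>a\<close> is left
  regular iff no nonzero such row is killed by \<open>a\<close>. For \<open>a \<in> \<Psi>\<close> a large initial segment of rows is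
  mapped into a space of smaller dimension. For \<open>a \<notin> \<Psi>\<close> a row whose last nonzero entry is at
  \<open>N > \<nu>(a)\<close> is not killed, because the entry of its image at \<open>N + deg a\<^sub>\<partial>\<close> is that last entry times
  the value at \<open>N + 1\<close> of the leading coefficient, which is nonzero beyond \<open>\<mu>(a)\<close>.\<close>

section \<open>The matrix of an operator\<close>

text \<open>The factor \<open>fact i / fact j\<close> passes from monomials to the basis
  \<open>x^k / k!\<close>, in which \<open>opD\<close> and \<open>opI\<close> are the two shifts and
  \<open>opH\<close> is diagonal with entries \<open>i + 1\<close>.\<close>

definition mtx :: "'k::field_char_0 intdiff \<Rightarrow> nat \<Rightarrow> nat \<Rightarrow> 'k" where
  "mtx a i j = coeff (Rep_intdiff a (monom 1 j)) i * fact i / fact j"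

lemma Rep_intdiff_add: "Rep_intdiff a (p + q) = Rep_intdiff a p + Rep_intdiff a q"
  and Rep_intdiff_smult: "Rep_intdiff a (smult c p) = smult c (Rep_intdiff a p)"
  using intdiff_ops_linear[OF Rep_intdiff] by blast+

lemma Rep_intdiff_0: "Rep_intdiff a 0 = 0"
  using Rep_intdiff_smult[of a 0 0] by simp

lemma Rep_intdiff_sum: "Rep_intdiff a (sum f A) = (\<Sum>x\<in>A. Rep_intdiff a (f x))"
  by (induction A rule: infinite_finite_induct) (auto simp: Rep_intdiff_0 Rep_intdiff_add)

lemma Rep_intdiff_expand:
  assumes "degree p \<le> n"
  shows "Rep_intdiff a p = (\<Sum>k\<le>n. smult (coeff p k) (Rep_intdiff a (monom 1 k)))"
proof -
  have "Rep_intdiff a p = Rep_intdiff a (\<Sum>k\<le>n. smult (coeff p k) (monom 1 k))"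
    using poly_as_sum_of_monoms'[OF assms] by (simp add: smult_monom)
  then show ?thesis by (simp add: Rep_intdiff_sum Rep_intdiff_smult)
qed

lemma mtx_inject: "a = b \<longleftrightarrow> (\<forall>i j. mtx a i j = mtx b i j)"
proof
  assume *: "\<forall>i j. mtx a i j = mtx b i j"
  have "Rep_intdiff a (monom 1 j) = Rep_intdiff b (monom 1 j)" for j
    using * by (intro poly_eqI) (auto simp: mtx_def field_simps)
  then have "Rep_intdiff a p = Rep_intdiff b p" for p
    unfolding Rep_intdiff_expand[OF order.refl[of "degree p"]] by simp
  then show "a = b" by (metis Rep_intdiff_inject ext)
qed simp

lemma mtx_0 [simp]: "mtx 0 i j = 0"
  by (simp add: mtx_def zero_intdiff.rep_eq)

lemma mtx_1: "mtx 1 i j = (if i = j then 1 else 0)"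
  by (auto simp: mtx_def one_intdiff.rep_eq)

lemma mtx_add [simp]: "mtx (a + b) i j = mtx a i j + mtx b i j"
  by (simp add: mtx_def plus_intdiff.rep_eq algebra_simps add_divide_distrib)

lemma mtx_diff [simp]: "mtx (a - b) i j = mtx a i j - mtx b i j"
  by (simp add: mtx_def minus_intdiff.rep_eq algebra_simps diff_divide_distrib)

lemma mtx_scl [simp]: "mtx (scl c a) i j = c * mtx a i j"
  by (simp add: mtx_def scl.rep_eq)

lemma mtx_sum: "mtx (sum f A) i j = (\<Sum>x\<in>A. mtx (f x) i j)"
  by (induction A rule: infinite_finite_induct) auto

text \<open>A column is the image of one monomial, hence a polynomial. Finiteness of rows is deeper
  and follows only from the canonical form.\<close>

lemma mtx_column_finite: "\<exists>N. \<forall>k>N. mtx a k j = 0"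
  by (rule exI[of _ "degree (Rep_intdiff a (monom 1 j))"]) (auto simp: mtx_def coeff_eq_0)

lemma mtx_mult_column:
  assumes "\<And>k. k > N \<Longrightarrow> mtx b k j = 0"
  shows "mtx (a * b) i j = (\<Sum>k\<le>N. mtx a i k * mtx b k j)"
proof -
  have "degree (Rep_intdiff b (monom 1 j)) \<le> N"
    using assms by (intro degree_le) (auto simp: mtx_def)
  then have "Rep_intdiff (a * b) (monom 1 j) =
      (\<Sum>k\<le>N. smult (coeff (Rep_intdiff b (monom 1 j)) k) (Rep_intdiff a (monom 1 k)))"
    by (simp only: times_intdiff.rep_eq o_apply Rep_intdiff_expand)
  then show ?thesis
    by (auto simp: mtx_def coeff_sum sum_distrib_right sum_divide_distrib intro!: sum.cong)
qed

text \<open>Column finiteness of \<open>b\<close> makes the product a finite sum up to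
  \<open>max M N\<close>; the terms beyond \<open>N\<close> vanish because of
  \<open>a\<close>.\<close>

lemma mtx_mult_row:
  assumes "\<And>k. k > N \<Longrightarrow> mtx a i k = 0"
  shows "mtx (a * b) i j = (\<Sum>k\<le>N. mtx a i k * mtx b k j)"
proof -
  obtain M where M: "\<And>k. k > M \<Longrightarrow> mtx b k j = 0"
    using mtx_column_finite by metis
  have "mtx (a * b) i j = (\<Sum>k\<le>max M N. mtx a i k * mtx b k j)"
    using M by (intro mtx_mult_column) auto
  also have "\<dots> = (\<Sum>k\<le>N. mtx a i k * mtx b k j)"
    using assms by (intro sum.mono_neutral_right) auto
  finally show ?thesis .
qed

section \<open>Left multiplication by generators as row operations\<close>

lemma mtx_opD_left: "mtx (opD * a) i j = mtx a (Suc i) j"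
  by (simp add: mtx_def times_intdiff.rep_eq opD.rep_eq coeff_pderiv field_simps)

lemma mtx_opI_left: "mtx (opI * a) i j = (case i of 0 \<Rightarrow> 0 | Suc i' \<Rightarrow> mtx a i' j)"
  by (auto simp: mtx_def times_intdiff.rep_eq opI.rep_eq coeff_pint field_simps
      simp del: of_nat_Suc split: nat.splits)

lemma mtx_opX_left:
  "mtx (opX * a) i j = (case i of 0 \<Rightarrow> 0 | Suc i' \<Rightarrow> of_nat i * mtx a i' j)"
  by (auto simp: mtx_def times_intdiff.rep_eq opX.rep_eq coeff_pCons field_simps
      simp del: of_nat_Suc split: nat.splits)

lemma mtx_opH_left: "mtx (opH * a) i j = of_nat (i + 1) * mtx a i j"
  by (simp add: opH_def mult.assoc mtx_opD_left mtx_opX_left)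

lemma mtx_opH_power_left: "mtx (opH ^ n * a) i j = of_nat (i + 1) ^ n * mtx a i j"
  by (induction n) (simp_all add: mult.assoc mtx_opH_left)

lemma mtx_opD_power_left: "mtx (opD ^ n * a) i j = mtx a (i + n) j"
  by (induction n arbitrary: i) (simp_all add: mult.assoc mtx_opD_left)

lemma mtx_opI_power_left: "mtx (opI ^ n * a) i j = (if n \<le> i then mtx a (i - n) j else 0)"
  by (induction n arbitrary: i) (auto simp: mult.assoc mtx_opI_left split: nat.splits)

text \<open>\<open>opH\<close> scales row \<open>i\<close> by \<open>i + 1\<close>, so a polynomial
  in \<open>opH\<close> scales it by its value there.\<close>

lemma mtx_atH_left: "mtx (atH d * a) i j = poly d (of_nat (i + 1)) * mtx a i j"
  by (simp add: atH_def sum_distrib_right mtx_sum scl_mult_left mtx_opH_power_left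
      poly_altdef mult.assoc del: of_nat_Suc of_nat_add)

lemma mtx_opD_power: "mtx (opD ^ n :: 'k::field_char_0 intdiff) i j = (if j = i + n then 1 else 0)"
  using mtx_opD_power_left[of n "1 :: 'k intdiff"] by (auto simp: mtx_1)

lemma mtx_atH: "mtx (atH d) i j = (if i = j then poly d (of_nat (i + 1)) else 0)"
  using mtx_atH_left[of d 1] by (auto simp: mtx_1)

text \<open>\<open>opI ^ p * opD ^ q\<close> has ones at all \<open>(p + t, q + t)\<close>;
  subtracting the next such product leaves only \<open>t = 0\<close>, a matrix unit.\<close>

lemma mtx_opE: "mtx (opE p q) i j = (if i = p \<and> j = q then 1 else 0)"
  unfolding opE_def mtx_diff mtx_opI_power_left by (auto simp: mtx_opD_power simp del: power_Suc)

lemma mtx_opE_left: "mtx (opE p q * a) i j = (if i = p then mtx a q j else 0)"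
proof -
  have "mtx (opE p q * a) i j = (\<Sum>k\<le>q. mtx (opE p q) i k * mtx a k j)"
    by (rule mtx_mult_row) (simp add: mtx_opE)
  also have "\<dots> = (\<Sum>k\<le>q. if k = q then if i = p then mtx a q j else 0 else 0)"
    by (intro sum.cong) (auto simp: mtx_opE)
  finally show ?thesis by simp
qed


section \<open>Finite matrices and diagonals\<close>

text \<open>The minimum reflects the side of the coefficients: left of powers of \<open>opD\<close>
  they are evaluated by row, right of powers of \<open>opI\<close> by column.\<close>

definition diag_entry :: "(int \<Rightarrow> 'k::field_char_0 poly) \<Rightarrow> nat \<Rightarrow> nat \<Rightarrow> 'k" where
  "diag_entry d i j = poly (d (int i - int j)) (of_nat (min i j + 1))"

lemma mtx_opE_sum:
  assumes "\<And>i j. i > n \<or> j > n \<Longrightarrow> M i j = 0"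
  shows "mtx (\<Sum>p\<le>n. \<Sum>q\<le>n. scl (M p q) (opE p q)) i j = M i j"
proof -
  have "mtx (\<Sum>p\<le>n. \<Sum>q\<le>n. scl (M p q) (opE p q)) i j =
      (\<Sum>p\<le>n. \<Sum>q\<le>n. if q = j then if p = i then M i j else 0 else 0)"
    unfolding mtx_sum mtx_scl mtx_opE by (intro sum.cong) auto
  also have "\<dots> = M i j"
    using assms[of i j] by (cases "i \<le> n"; cases "j \<le> n") simp_all
  finally show ?thesis .
qed

lemma span_opE_eq:
  "intdiff.span {opE i j | i j. i \<le> n \<and> j \<le> n} =
     {f :: 'k::field_char_0 intdiff. \<forall>i j. i > n \<or> j > n \<longrightarrow> mtx f i j = 0}" (is "?L = ?R")
proof
  show "?L \<subseteq> ?R"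
  proof
    fix f assume "f \<in> ?L"
    then show "f \<in> ?R"
      by (induction rule: intdiff.span_induct_alt) (auto simp: mtx_opE)
  qed
  show "?R \<subseteq> ?L"
  proof
    fix f assume f: "f \<in> ?R"
    have "f = (\<Sum>p\<le>n. \<Sum>q\<le>n. scl (mtx f p q) (opE p q))"
      unfolding mtx_inject by (intro allI mtx_opE_sum[symmetric]) (use f in blast)
    moreover have "\<dots> \<in> ?L"
      by (intro intdiff.span_sum intdiff.span_scale intdiff.span_base) auto
    ultimately show "f \<in> ?L" by simp
  qed
qed

lemma idealF_iff: "f \<in> idealF \<longleftrightarrow> (\<exists>n. \<forall>i j. i > n \<or> j > n \<longrightarrow> mtx f i j = 0)"
proof
  assume "f \<in> idealF"
  then show "\<exists>n. \<forall>i j. i > n \<or> j > n \<longrightarrow> mtx f i j = 0"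
    unfolding idealF_def
  proof (induction rule: intdiff.span_induct_alt)
    case (step c x y)
    then obtain p q n where "x = opE p q" "\<forall>i j. i > n \<or> j > n \<longrightarrow> mtx y i j = 0" by auto
    then show ?case by (intro exI[of _ "max n (max p q)"]) (auto simp: mtx_opE)
  qed simp
next
  assume "\<exists>n. \<forall>i j. i > n \<or> j > n \<longrightarrow> mtx f i j = 0"
  then obtain n where "f \<in> intdiff.span {opE i j | i j. i \<le> n \<and> j \<le> n}"
    unfolding span_opE_eq by auto
  also have "\<dots> \<subseteq> idealF"
    unfolding idealF_def by (rule intdiff.span_mono) auto
  finally show "f \<in> idealF" .
qed

lemma mtx_atH_opD_power:
  "mtx (atH e * opD ^ n) i j = (if j = i + n then poly e (of_nat (i + 1)) else 0)"
  by (simp add: mtx_atH_left mtx_opD_power)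

lemma mtx_opI_power_atH:
  "mtx (opI ^ n * atH e) i j = (if i = j + n then poly e (of_nat (j + 1)) else 0)"
  by (auto simp: mtx_opI_power_left mtx_atH)

lemma mtx_upper_sum:
  assumes "finite S" "\<And>n. n \<notin> S \<Longrightarrow> d (- int n) = 0"
  shows "mtx (\<Sum>n\<in>S. atH (d (- int n)) * opD ^ n) i j = (if i \<le> j then diag_entry d i j else 0)"
proof -
  have "mtx (\<Sum>n\<in>S. atH (d (- int n)) * opD ^ n) i j =
      (\<Sum>n\<in>S. if n = j - i then if i \<le> j then diag_entry d i j else 0 else 0)"
    unfolding mtx_sum mtx_atH_opD_power
    by (intro sum.cong) (auto simp: diag_entry_def min_def of_nat_diff)
  also have "\<dots> = (if i \<le> j then diag_entry d i j else 0)"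
    \<comment> \<open>If \<open>j - i\<close> lies outside \<open>S\<close>, the sum is zero, and so
      is the coefficient on that diagonal.\<close>
    using assms(1) assms(2)[of "j - i"] by (auto simp: diag_entry_def of_nat_diff)
  finally show ?thesis .
qed

lemma mtx_lower_sum:
  assumes "finite S" "0 \<notin> S" "\<And>n. n \<notin> S \<Longrightarrow> n \<noteq> 0 \<Longrightarrow> d (int n) = 0"
  shows "mtx (\<Sum>n\<in>S. opI ^ n * atH (d (int n))) i j = (if j < i then diag_entry d i j else 0)"
proof -
  have "mtx (\<Sum>n\<in>S. opI ^ n * atH (d (int n))) i j =
      (\<Sum>n\<in>S. if n = i - j then if j < i then diag_entry d i j else 0 else 0)"
    unfolding mtx_sum mtx_opI_power_atH using assms(2)
    by (intro sum.cong) (auto simp: diag_entry_def min_def of_nat_diff)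
  also have "\<dots> = (if j < i then diag_entry d i j else 0)"
    using assms(1) assms(3)[of "i - j"] by (auto simp: diag_entry_def of_nat_diff)
  finally show ?thesis .
qed

lemma finite_support_bounds:
  "finite {k. d k \<noteq> 0} \<longleftrightarrow> (\<exists>l m :: nat. \<forall>k. k < - int l \<or> int m < k \<longrightarrow> d k = (0 :: 'k::zero))"
proof
  assume fin: "finite {k. d k \<noteq> 0}"
  define B where "B = Max (insert 0 ((\<lambda>k. nat \<bar>k\<bar>) ` {k. d k \<noteq> 0}))"
  have "nat \<bar>k\<bar> \<le> B" if "d k \<noteq> 0" for k
    unfolding B_def using fin that by (intro Max_ge) auto
  then show "\<exists>l m :: nat. \<forall>k. k < - int l \<or> int m < k \<longrightarrow> d k = 0"
    by (intro exI[of _ B]) force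
next
  assume "\<exists>l m :: nat. \<forall>k. k < - int l \<or> int m < k \<longrightarrow> d k = 0"
  then obtain l m :: nat where "\<And>k. k < - int l \<or> int m < k \<Longrightarrow> d k = 0" by blast
  then have "{k. d k \<noteq> 0} \<subseteq> {- int l..int m}" by force
  then show "finite {k. d k \<noteq> 0}" by (rule finite_subset) simp
qed

text \<open>The powers of \<open>opD\<close> fill the entries with \<open>i <= j\<close> and those
  of \<open>opI\<close> the entries with \<open>j < i\<close>, so both sums together form
  \<open>diag_entry d\<close>.\<close>

lemma canonical_form_iff:
  "canonical_form a d f \<longleftrightarrow> f \<in> idealF \<and> finite {k. d k \<noteq> 0} \<and>
     (\<forall>i j. mtx a i j = diag_entry d i j + mtx f i j)"
proof -
  have *: "a = (\<Sum>i = 0..l. atH (d (- int i)) * opD ^ i) + (\<Sum>j = 1..m. opI ^ j * atH (d (int j))) + f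
      \<longleftrightarrow> (\<forall>i j. mtx a i j = diag_entry d i j + mtx f i j)"
    if "\<forall>k. k < - int l \<or> int m < k \<longrightarrow> d k = 0" for l m
  proof -
    have 1: "mtx (\<Sum>i = 0..l. atH (d (- int i)) * opD ^ i) i j = (if i \<le> j then diag_entry d i j else 0)"
      for i j
      using that by (intro mtx_upper_sum) auto
    have 2: "mtx (\<Sum>j = 1..m. opI ^ j * atH (d (int j))) i j = (if j < i then diag_entry d i j else 0)"
      for i j
      using that by (intro mtx_lower_sum) auto
    show ?thesis
      unfolding mtx_inject[of a] mtx_add 1 2 by (intro iff_allI) auto
  qed
  then show ?thesis
    unfolding canonical_form_def finite_support_bounds by blast
qed

text \<open>Realizes a prescribed matrix by an operator: the diagonals come from the canonical form,
  and the finite discrepancy is a combination of matrix units.\<close>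

lemma exists_mtx:
  fixes M :: "nat \<Rightarrow> nat \<Rightarrow> 'k::field_char_0"
  assumes "finite {k. d k \<noteq> 0}" "\<And>i j. i > n \<or> j > n \<Longrightarrow> M i j = diag_entry d i j"
  shows "\<exists>a. \<forall>i j. mtx a i j = M i j"
proof -
  define f where "f = (\<Sum>p\<le>n. \<Sum>q\<le>n. scl (M p q - diag_entry d p q) (opE p q))"
  have f: "mtx f i j = M i j - diag_entry d i j" for i j
    unfolding f_def using assms(2) by (subst mtx_opE_sum) auto
  obtain l m :: nat where lm: "\<forall>k. k < - int l \<or> int m < k \<longrightarrow> d k = 0"
    using assms(1) unfolding finite_support_bounds by blast
  have "f \<in> idealF"
    unfolding idealF_iff using assms(2) by (auto simp: f)
  moreover define a where
    "a = (\<Sum>i = 0..l. atH (d (- int i)) * opD ^ i) + (\<Sum>j = 1..m. opI ^ j * atH (d (int j))) + f"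
  ultimately have "canonical_form a d f"
    unfolding canonical_form_def using lm by blast
  then show ?thesis
    unfolding canonical_form_iff by (intro exI[of _ a]) (simp add: f)
qed


section \<open>Existence and uniqueness of the canonical form\<close>

text \<open>The canonical form with its \<open>F\<close>-part left implicit, so that closure proofs
  need to follow only the diagonals.\<close>

definition has_symbol :: "'k::field_char_0 intdiff \<Rightarrow> (int \<Rightarrow> 'k poly) \<Rightarrow> bool" where
  "has_symbol a d \<longleftrightarrow> finite {k. d k \<noteq> 0} \<and>
     (\<exists>n. \<forall>i j. i > n \<or> j > n \<longrightarrow> mtx a i j = diag_entry d i j)"

lemma has_symbol_iff: "has_symbol a d \<longleftrightarrow> (\<exists>f. canonical_form a d f)"
proof
  assume "has_symbol a d"
  then obtain n where fin: "finite {k. d k \<noteq> 0}"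
    and n: "\<And>i j. i > n \<or> j > n \<Longrightarrow> mtx a i j = diag_entry d i j"
    unfolding has_symbol_def by blast
  \<comment> \<open>With the zero symbol, \<open>exists_mtx\<close> produces an operator from a
    finite block; this one is the \<open>F\<close>-part.\<close>
  obtain f where "\<forall>i j. mtx f i j = mtx a i j - diag_entry d i j"
    using exists_mtx[of "\<lambda>_. 0" n "\<lambda>i j. mtx a i j - diag_entry d i j"] n
    by (auto simp: diag_entry_def)
  then have "canonical_form a d f"
    unfolding canonical_form_iff idealF_iff using fin n by (intro conjI exI[of _ n]) auto
  then show "\<exists>f. canonical_form a d f" ..
next
  assume "\<exists>f. canonical_form a d f"
  then obtain f n where "finite {k. d k \<noteq> 0}" "\<forall>i j. i > n \<or> j > n \<longrightarrow> mtx f i j = 0"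
    "\<forall>i j. mtx a i j = diag_entry d i j + mtx f i j"
    unfolding canonical_form_iff idealF_iff by blast
  then show "has_symbol a d"
    unfolding has_symbol_def by (intro conjI exI[of _ n]) simp_all
qed

section \<open>Closure properties of operators with a symbol\<close>

lemma finite_support_shift:
  assumes "finite {k::int. d k \<noteq> 0}" "\<And>k. d (k + c) = 0 \<Longrightarrow> d' k = 0"
  shows "finite {k. d' k \<noteq> 0}"
proof (rule finite_subset)
  show "{k. d' k \<noteq> 0} \<subseteq> (\<lambda>k. k - c) ` {k. d k \<noteq> 0}"
    using assms(2) by (force simp: image_iff intro: exI[of _ "_ + c"])
  show "finite ((\<lambda>k. k - c) ` {k. d k \<noteq> 0})"
    using assms(1) by (rule finite_imageI)
qed

text \<open>Entry \<open>(i, j)\<close> comes from \<open>(i + 1, j)\<close>, on diagonal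
  \<open>k + 1\<close>. The smaller index grows by one exactly when \<open>i < j\<close>, that is
  \<open>k < 0\<close>, whence the shifted polynomial.\<close>

lemma has_symbol_opD_left:
  assumes "has_symbol b d"
  shows "has_symbol (opD * b) (\<lambda>k. if k < 0 then pcompose (d (k + 1)) [:1, 1:] else d (k + 1))"
    (is "has_symbol _ ?d")
proof -
  obtain n where fin: "finite {k. d k \<noteq> 0}"
    and n: "\<And>i j. i > n \<or> j > n \<Longrightarrow> mtx b i j = diag_entry d i j"
    using assms unfolding has_symbol_def by blast
  have "diag_entry d (Suc i) j = diag_entry ?d i j" for i j
    by (auto simp: diag_entry_def poly_pcompose min_def algebra_simps)
  with n have "\<forall>i j. i > n \<or> j > n \<longrightarrow> mtx (opD * b) i j = diag_entry ?d i j"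
    by (simp add: mtx_opD_left)
  moreover have "finite {k. ?d k \<noteq> 0}"
    using fin by (rule finite_support_shift[where c = 1]) simp
  ultimately show ?thesis unfolding has_symbol_def by blast
qed

lemma has_symbol_opI_left:
  assumes "has_symbol b d"
  shows "has_symbol (opI * b) (\<lambda>k. if k \<le> 0 then pcompose (d (k - 1)) [:- 1, 1:] else d (k - 1))"
    (is "has_symbol _ ?d")
proof -
  obtain n where fin: "finite {k. d k \<noteq> 0}"
    and n: "\<And>i j. i > n \<or> j > n \<Longrightarrow> mtx b i j = diag_entry d i j"
    using assms unfolding has_symbol_def by blast
  \<comment> \<open>The product has a zero row 0, where \<open>?d\<close> need not vanish. Beyond
    column \<open>l\<close> it does, so the exceptional block is enlarged by
    \<open>l\<close>.\<close>
  obtain l :: nat where l: "\<And>k. k < - int l \<Longrightarrow> d k = 0"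
    using fin unfolding finite_support_bounds by blast
  have "diag_entry d i j = diag_entry ?d (Suc i) j" for i j
    by (cases i j rule: linorder_cases) (auto simp: diag_entry_def poly_pcompose algebra_simps)
  moreover have "diag_entry ?d 0 j = 0" if "j > l" for j
    using that by (simp add: diag_entry_def l)
  ultimately have "mtx (opI * b) i j = diag_entry ?d i j" if "i > Suc (n + l) \<or> j > Suc (n + l)" for i j
    using n[of "i - 1" j] that by (cases i) (auto simp: mtx_opI_left)
  then have "\<forall>i j. i > Suc (n + l) \<or> j > Suc (n + l) \<longrightarrow> mtx (opI * b) i j = diag_entry ?d i j"
    by blast
  moreover have "finite {k. ?d k \<noteq> 0}"
    using fin by (rule finite_support_shift[where c = "- 1"]) simp
  ultimately show ?thesis unfolding has_symbol_def by blast
qed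

text \<open>The row factor is \<open>i + 1 = (min i j + 1) + max k 0\<close> on the diagonal
  \<open>k = i - j\<close>.\<close>

lemma has_symbol_opH_left:
  assumes "has_symbol b d"
  shows "has_symbol (opH * b) (\<lambda>k. [:of_int (max k 0), 1:] * d k)" (is "has_symbol _ ?d")
proof -
  obtain n where fin: "finite {k. d k \<noteq> 0}"
    and n: "\<And>i j. i > n \<or> j > n \<Longrightarrow> mtx b i j = diag_entry d i j"
    using assms unfolding has_symbol_def by blast
  have "of_nat (i + 1) * diag_entry d i j = diag_entry ?d i j" for i j
    by (auto simp: diag_entry_def min_def max_def algebra_simps)
  with n have "\<forall>i j. i > n \<or> j > n \<longrightarrow> mtx (opH * b) i j = diag_entry ?d i j"
    by (simp add: mtx_opH_left)
  moreover have "finite {k. ?d k \<noteq> 0}"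
    using fin by (rule finite_support_shift[where c = 0]) simp
  ultimately show ?thesis unfolding has_symbol_def by blast
qed

lemma has_symbol_add:
  assumes "has_symbol a d" "has_symbol b e"
  shows "has_symbol (a + b) (\<lambda>k. d k + e k)"
proof -
  obtain n where fin: "finite {k. d k \<noteq> 0}"
    and n: "\<And>i j. i > n \<or> j > n \<Longrightarrow> mtx a i j = diag_entry d i j"
    using assms unfolding has_symbol_def by blast
  obtain m where fin': "finite {k. e k \<noteq> 0}"
    and m: "\<And>i j. i > m \<or> j > m \<Longrightarrow> mtx b i j = diag_entry e i j"
    using assms unfolding has_symbol_def by blast
  have "finite {k. d k + e k \<noteq> 0}"
    by (rule finite_subset[OF _ finite_UnI[OF fin fin']]) auto
  then show ?thesis
    unfolding has_symbol_def using n m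
    by (intro conjI exI[of _ "max n m"]) (auto simp: diag_entry_def)
qed

lemma has_symbol_scl:
  assumes "has_symbol a d"
  shows "has_symbol (scl c a) (\<lambda>k. smult c (d k))"
proof -
  obtain n where fin: "finite {k. d k \<noteq> 0}"
    and n: "\<And>i j. i > n \<or> j > n \<Longrightarrow> mtx a i j = diag_entry d i j"
    using assms unfolding has_symbol_def by blast
  have "finite {k. smult c (d k) \<noteq> 0}"
    using fin by (rule finite_support_shift[where c = 0]) simp
  then show ?thesis
    unfolding has_symbol_def using n by (intro conjI exI[of _ n]) (auto simp: diag_entry_def)
qed

text \<open>Transfers the inductive generation of \<open>intdiff_ops\<close> to the abstract
  type.\<close>

lemma intdiff_induct [case_names opX opD opI one add scl mult]:
  fixes a :: "'k::field_char_0 intdiff"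
  assumes "P opX" "P opD" "P opI" "P 1" "\<And>a b. P a \<Longrightarrow> P b \<Longrightarrow> P (a + b)"
    "\<And>c a. P a \<Longrightarrow> P (scl c a)" "\<And>a b. P a \<Longrightarrow> P b \<Longrightarrow> P (a * b)"
  shows "P a"
proof -
  have "P (Abs_intdiff f)" if "f \<in> intdiff_ops" for f :: "'k poly \<Rightarrow> 'k poly"
    using that
  proof (induction rule: intdiff_ops.induct)
    case gen_x
    show ?case using assms(1) by (simp only: opX_def)
  next
    case gen_deriv
    show ?case using assms(2) by (simp only: opD_def)
  next
    case gen_int
    show ?case using assms(3) by (simp only: opI_def)
  next
    case one
    show ?case using assms(4) by (simp only: one_intdiff_def)
  next
    case (add f g)
    then have "Abs_intdiff f + Abs_intdiff g = Abs_intdiff (\<lambda>p. f p + g p)"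
      by (simp only: plus_intdiff.abs_eq eq_onp_same_args)
    with assms(5)[OF add.IH] show ?case by simp
  next
    case (scale f c)
    then have "scl c (Abs_intdiff f) = Abs_intdiff (\<lambda>p. smult c (f p))"
      by (simp only: scl.abs_eq eq_onp_same_args)
    with assms(6)[OF scale.IH, of c] show ?case by simp
  next
    case (comp f g)
    then have "Abs_intdiff f * Abs_intdiff g = Abs_intdiff (f \<circ> g)"
      by (simp only: times_intdiff.abs_eq eq_onp_same_args)
    with assms(7)[OF comp.IH] show ?case by (simp only:)
  qed
  from this[OF Rep_intdiff[of a]] show ?thesis by (simp add: Rep_intdiff_inverse)
qed

lemma ex_has_symbol: "\<exists>d. has_symbol a d"
proof -
  \<comment> \<open>Strengthened to all right factors \<open>b\<close>: products then follow by
    associativity, without a formula for the symbol of a product.\<close>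
  have "\<forall>b. (\<exists>d. has_symbol b d) \<longrightarrow> (\<exists>d. has_symbol (a * b) d)"
  proof (induction a rule: intdiff_induct)
    case opX
    then show ?case
      unfolding opX_eq mult.assoc using has_symbol_opI_left has_symbol_opH_left by blast
  next
    case opD
    then show ?case using has_symbol_opD_left by blast
  next
    case opI
    then show ?case using has_symbol_opI_left by blast
  next
    case (add a b)
    then show ?case unfolding distrib_right using has_symbol_add by blast
  next
    case (scl c a)
    then show ?case unfolding scl_mult_left using has_symbol_scl by blast
  next
    case (mult a b)
    then show ?case unfolding mult.assoc by blast
  qed simp
  moreover have "has_symbol 1 (\<lambda>k. if k = 0 then 1 else 0)"
    unfolding has_symbol_def by (auto simp: mtx_1 diag_entry_def)
  ultimately have "\<exists>d. has_symbol (a * 1) d" by blast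
  then show ?thesis by simp
qed

text \<open>Beyond both blocks, each diagonal gives the values of its polynomial at infinitely many
  integers.\<close>

lemma has_symbol_unique:
  fixes a :: "'k::field_char_0 intdiff"
  assumes "has_symbol a d" "has_symbol a e"
  shows "d = e"
proof
  fix k
  obtain n where n: "\<And>i j. i > n \<or> j > n \<Longrightarrow> mtx a i j = diag_entry d i j"
    using assms unfolding has_symbol_def by blast
  obtain m where m: "\<And>i j. i > m \<or> j > m \<Longrightarrow> mtx a i j = diag_entry e i j"
    using assms unfolding has_symbol_def by blast
  have "poly (d k - e k) (of_nat (t + n + m + 2)) = 0" for t
  proof -
    \<comment> \<open>One of \<open>nat k\<close> and \<open>nat (- k)\<close> is zero, so this is a
      position on diagonal \<open>k\<close> with smaller index \<open>t + n + m + 1\<close>.\<close>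
    let ?i = "t + n + m + 1 + nat k" and ?j = "t + n + m + 1 + nat (- k)"
    have "diag_entry d ?i ?j = diag_entry e ?i ?j"
      using n[of ?i ?j] m[of ?i ?j] by simp
    moreover have "int ?i - int ?j = k" "min ?i ?j + 1 = t + n + m + 2"
      by (auto simp: min_def)
    ultimately show ?thesis
      by (simp only: diag_entry_def poly_diff) simp
  qed
  then have "range (\<lambda>t. of_nat (t + n + m + 2)) \<subseteq> {x. poly (d k - e k) x = 0}"
    by auto
  moreover have "infinite (range (\<lambda>t. of_nat (t + n + m + 2) :: 'k))"
    by (intro range_inj_infinite injI) (simp only: of_nat_eq_iff)
  ultimately show "d k = e k"
    using poly_roots_finite[of "d k - e k"] finite_subset by auto
qed

lemma dcoeff_eq:
  assumes "has_symbol a d"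
  shows "dcoeff a = d"
  unfolding dcoeff_def using assms
  by (intro the_equality) (auto simp flip: has_symbol_iff intro: has_symbol_unique)

lemma has_symbol_dcoeff: "has_symbol a (dcoeff a)"
  using ex_has_symbol dcoeff_eq by metis

lemma canonical_form_F_part: "canonical_form a (dcoeff a) (F_part a)"
proof -
  obtain f where f: "canonical_form a (dcoeff a) f"
    using has_symbol_dcoeff has_symbol_iff by blast
  have "F_part a = f"
    unfolding F_part_def
  proof (rule the_equality)
    show "g = f" if g: "\<exists>d. canonical_form a d g" for g
    proof -
      obtain d where d: "canonical_form a d g" using g by blast
      then have "dcoeff a = d" using dcoeff_eq has_symbol_iff by blast
      with d f show ?thesis by (auto simp: canonical_form_iff mtx_inject)
    qed
  qed (use f in blast)
  with f show ?thesis by simp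
qed

lemma mtx_canonical: "mtx a i j = diag_entry (dcoeff a) i j + mtx (F_part a) i j"
  using canonical_form_F_part by (auto simp: canonical_form_iff)

text \<open>Only finitely many diagonals above the main one carry a nonzero polynomial, and the
  remaining part is a finite block.\<close>

lemma mtx_row_finite: "\<exists>N. \<forall>k>N. mtx a i k = 0"
proof -
  obtain n where fin: "finite {k. dcoeff a k \<noteq> 0}"
    and n: "\<And>i j. i > n \<or> j > n \<Longrightarrow> mtx a i j = diag_entry (dcoeff a) i j"
    using has_symbol_dcoeff[of a] unfolding has_symbol_def by blast
  obtain l :: nat where l: "\<And>k. k < - int l \<Longrightarrow> dcoeff a k = 0"
    using fin unfolding finite_support_bounds by blast
  show ?thesis
    by (intro exI[of _ "n + l + i"]) (simp add: n diag_entry_def l)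
qed


section \<open>The invariants\<close>

lemma mtx_F_part_eq_0:
  assumes "int i > op_size a \<or> int j > op_size a"
  shows "mtx (F_part a) i j = 0"
proof (cases "F_part a = 0")
  case False
  have "\<exists>n. F_part a \<in> intdiff.span {opE i j | i j. i \<le> n \<and> j \<le> n}"
    using canonical_form_F_part[of a] unfolding canonical_form_iff idealF_iff span_opE_eq by blast
  then have "F_part a \<in> intdiff.span {opE i j | i j. i \<le> nat (op_size a) \<and> j \<le> nat (op_size a)}"
    using LeastI_ex[where P = "\<lambda>n. F_part a \<in> intdiff.span {opE i j | i j. i \<le> n \<and> j \<le> n}"] False
    by (simp add: op_size_def)
  moreover have "op_size a \<ge> 0" using False by (simp add: op_size_def)
  ultimately show ?thesis using assms unfolding span_opE_eq by auto
qed simp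

lemma poly_tau_power: "poly ((tau ^^ i) p) x = poly p (x + of_nat i)"
  by (induction i arbitrary: x) (simp_all add: tau_def poly_pcompose algebra_simps)

text \<open>Applying \<open>tau\<close> \<open>mu_poly p\<close> times moves the roots down by that
  amount, after which no positive integer is a root.\<close>

lemma poly_neq_0_above_mu_poly:
  fixes p :: "'k::field_char_0 poly"
  assumes "p \<noteq> 0" "k > mu_poly p"
  shows "poly p (of_nat k) \<noteq> 0"
proof -
  \<comment> \<open>A bound on the natural roots shows that the minimum defining
    \<open>mu_poly p\<close> is attained.\<close>
  have "finite ((of_nat :: nat \<Rightarrow> 'k) -` {x. poly p x = 0})"
    using poly_roots_finite[OF assms(1)] by (intro finite_vimageI) (auto intro: injI)
  then obtain N where N: "\<And>n. poly p (of_nat n) = 0 \<Longrightarrow> n \<le> N"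
    unfolding finite_nat_set_iff_bounded_le by auto
  have "\<forall>k\<ge>1. poly ((tau ^^ N) p) (of_nat k) \<noteq> 0"
    using N[of "_ + N"] by (force simp: poly_tau_power)
  then have "\<forall>k\<ge>1. poly ((tau ^^ mu_poly p) p) (of_nat k) \<noteq> 0"
    unfolding mu_poly_def by (rule LeastI)
  then have "poly ((tau ^^ mu_poly p) p) (of_nat (k - mu_poly p)) \<noteq> 0"
    using assms(2) by (metis less_iff_Suc_add add_diff_cancel_left' le_add1 plus_1_eq_Suc add_Suc_right)
  then show ?thesis
    using assms(2) by (simp add: poly_tau_power of_nat_diff)
qed

lemma mtx_above_nu:
  assumes "i > nu a \<or> j > nu a"
  shows "mtx a i j = diag_entry (dcoeff a) i j"
proof -
  have "int i > op_size a \<or> int j > op_size a"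
    using assms unfolding nu_def by linarith
  then show ?thesis by (simp add: mtx_canonical[of a] mtx_F_part_eq_0)
qed

lemma finite_dcoeff: "finite {k. dcoeff a k \<noteq> 0}"
  using has_symbol_dcoeff has_symbol_def by blast

lemma finite_dcoeff_upper: "finite {i. dcoeff a (- int i) \<noteq> 0}"
proof -
  have "finite ((\<lambda>i. - int i) -` {k. dcoeff a k \<noteq> 0})"
    by (rule finite_vimageI[OF finite_dcoeff]) (simp add: inj_on_def)
  then show ?thesis by (simp add: vimage_def)
qed

lemma dcoeff_D_part: "dcoeff (D_part a) = (\<lambda>k. if k \<le> 0 then dcoeff a k else 0)" (is "_ = ?d")
proof (rule dcoeff_eq)
  have "mtx (D_part a) i j = (if i \<le> j then diag_entry (dcoeff a) i j else 0)" for i j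
    unfolding D_part_def using finite_dcoeff_upper by (rule mtx_upper_sum) simp
  then have "mtx (D_part a) i j = diag_entry ?d i j" for i j
    by (simp add: diag_entry_def)
  moreover have "finite {k. ?d k \<noteq> 0}"
    using finite_dcoeff[of a] by (rule finite_support_shift[where c = 0]) simp
  ultimately show "has_symbol (D_part a) ?d"
    unfolding has_symbol_def by blast
qed

lemma deg_D_D_part: "deg_D (D_part a) = Max {i. dcoeff a (- int i) \<noteq> 0}"
  by (simp add: deg_D_def dcoeff_D_part)

lemma dcoeff_below_deg_D:
  assumes "i > deg_D (D_part a)"
  shows "dcoeff a (- int i) = 0"
  using assms Max_ge[OF finite_dcoeff_upper, of i a] by (auto simp: deg_D_D_part)

lemma Psi_iff: "a \<in> Psi \<longleftrightarrow> (\<forall>i. dcoeff a (- int i) = 0)"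
proof
  assume "a \<in> Psi"
  then obtain m d f where f: "f \<in> idealF" and a: "a = (\<Sum>j = 1..m. opI ^ j * atH (d j)) + f"
    unfolding Psi_def by blast
  \<comment> \<open>Extends the finitely many coefficients given by \<open>Psi\<close> by zero, to a
    family indexed by all integers.\<close>
  define e where "e k = (if 1 \<le> k \<and> k \<le> int m then d (nat k) else 0)" for k
  have "a = (\<Sum>j = 1..m. opI ^ j * atH (e (int j))) + f"
    unfolding a e_def by (auto intro!: sum.cong)
  moreover have "mtx (\<Sum>j = 1..m. opI ^ j * atH (e (int j))) i j = (if j < i then diag_entry e i j else 0)"
    for i j
    by (intro mtx_lower_sum) (auto simp: e_def)
  moreover have "diag_entry e i j = 0" if "\<not> j < i" for i j
    using that by (simp add: diag_entry_def e_def)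
  moreover have "finite {k. e k \<noteq> 0}"
    by (rule finite_subset[of _ "{1..int m}"]) (auto simp: e_def)
  ultimately have "canonical_form a e f"
    using f unfolding canonical_form_iff by auto
  then have "dcoeff a = e"
    using dcoeff_eq has_symbol_iff by blast
  then show "\<forall>i. dcoeff a (- int i) = 0"
    by (simp add: e_def)
next
  assume *: "\<forall>i. dcoeff a (- int i) = 0"
  obtain l m where "a = (\<Sum>i = 0..l. atH (dcoeff a (- int i)) * opD ^ i)
      + (\<Sum>j = 1..m. opI ^ j * atH (dcoeff a (int j))) + F_part a"
    and f: "F_part a \<in> idealF"
    using canonical_form_F_part[of a] unfolding canonical_form_def by blast
  then have "a = (\<Sum>j = 1..m. opI ^ j * atH (dcoeff a (int j))) + F_part a"
    using * by (simp add: atH_def)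
  with f show "a \<in> Psi"
    unfolding Psi_def by (intro CollectI exI[of _ m] exI[of _ "\<lambda>j. dcoeff a (int j)"] exI[of _ "F_part a"]) simp
qed

lemma dcoeff_deg_D_neq_0:
  assumes "a \<notin> Psi"
  shows "dcoeff a (- int (deg_D (D_part a))) \<noteq> 0"
  using assms Max_in[OF finite_dcoeff_upper, of a] by (auto simp: deg_D_D_part Psi_iff)

text \<open>Since \<open>i\<close> exceeds both \<open>op_size a\<close> and \<open>mu a\<close>,
  the entry is the value of the leading coefficient at \<open>i + 1\<close>, beyond its roots in the
  positive integers.\<close>

lemma mtx_leading:
  assumes "a \<notin> Psi" "i > nu a"
  shows "mtx a i (i + deg_D (D_part a)) \<noteq> 0"
proof -
  have "poly (dcoeff a (- int (deg_D (D_part a)))) (of_nat (i + 1)) \<noteq> 0"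
    using assms by (intro poly_neq_0_above_mu_poly dcoeff_deg_D_neq_0) (auto simp: nu_def mu_def)
  then show ?thesis
    using assms(2) by (simp add: mtx_above_nu diag_entry_def)
qed

text \<open>Only the column has to exceed \<open>nu a\<close>, so this also applies to rows meeting
  the exceptional block.\<close>

lemma mtx_right_of_leading:
  assumes "j > nu a" "j > i + deg_D (D_part a)"
  shows "mtx a i j = 0"
  using dcoeff_below_deg_D[of a "j - i"] assms
  by (simp add: mtx_above_nu diag_entry_def of_nat_diff)


section \<open>The right module of rows\<close>

text \<open>The class of \<open>u\<close> in \<open>P1\<close> is the zeroth row of the matrix of \<open>u\<close>, and operators act
  on it by right multiplication of their matrix.\<close>

lemma ideal_P1_iff: "a \<in> ideal_P1 \<longleftrightarrow> (\<forall>j. mtx a 0 j = 0)"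
proof
  assume "a \<in> ideal_P1"
  then show "\<forall>j. mtx a 0 j = 0"
    by (auto simp: ideal_P1_def mtx_opI_left mtx_opH_left left_diff_distrib)
next
  assume "\<forall>j. mtx a 0 j = 0"
  \<comment> \<open>\<open>opI * opD\<close> is \<open>1 - opE 0 0\<close>, so it only erases row 0,
    which is already zero here.\<close>
  then have "a = opI * (opD * a) + (opH - 1) * 0"
    by (auto simp: mtx_inject mtx_opI_left mtx_opD_left split: nat.splits)
  then show "a \<in> ideal_P1" unfolding ideal_P1_def by blast
qed

lemma P1_class_eq_iff: "P1_class u = P1_class v \<longleftrightarrow> (\<forall>j. mtx u 0 j = mtx v 0 j)"
proof -
  have "P1_class u = P1_class v \<longleftrightarrow> u - v \<in> ideal_P1" by transfer simp
  then show ?thesis by (simp add: ideal_P1_iff)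
qed

lemma P1_act_class: "P1_act (P1_class u) a = P1_class (u * a)"
  by transfer (simp add: ideal_P1_0)

lemma mtx_row: "mtx (\<Sum>k\<le>n. scl (c k) (opD ^ k)) 0 j = (if j \<le> n then c j else 0)"
proof -
  have "mtx (\<Sum>k\<le>n. scl (c k) (opD ^ k)) 0 j = (\<Sum>k\<le>n. if k = j then c j else 0)"
    unfolding mtx_sum mtx_scl mtx_opD_power by (intro sum.cong) auto
  then show ?thesis by simp
qed

lemma P1_class_in_P1_le_iff: "P1_class u \<in> P1_le n \<longleftrightarrow> (\<forall>j>n. mtx u 0 j = 0)"
proof -
  have "P1_class u \<in> P1_le n \<longleftrightarrow> (\<exists>c. \<forall>j. mtx u 0 j = (if j \<le> n then c j else 0))"
    by (simp add: P1_le_def P1_class_eq_iff mtx_row)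
  also have "\<dots> \<longleftrightarrow> (\<forall>j>n. mtx u 0 j = 0)"
    by (metis not_le)
  finally show ?thesis .
qed

lemma P1_le_eq: "P1_le n = {P1_class u | u. \<forall>j>n. mtx u 0 j = 0}"
proof -
  have "\<exists>u. p = P1_class u" if "p \<in> P1_le n" for p :: "'a P1"
    using that unfolding P1_le_def by blast
  then show ?thesis using P1_class_in_P1_le_iff by blast
qed

text \<open>By additivity, injectivity is triviality of the kernel; the form matches
  \<open>left_regular_iff\<close> up to the support condition.\<close>

lemma inj_on_P1_act_iff:
  "inj_on (\<lambda>p. P1_act p a) (P1_le n) \<longleftrightarrow>
     (\<forall>u. (\<forall>j>n. mtx u 0 j = 0) \<longrightarrow> (\<forall>j. mtx (u * a) 0 j = 0) \<longrightarrow> (\<forall>j. mtx u 0 j = 0))"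
  (is "_ \<longleftrightarrow> ?R")
proof
  assume inj: "inj_on (\<lambda>p. P1_act p a) (P1_le n)"
  show ?R
  proof (intro allI impI)
    fix u j
    assume "\<forall>j>n. mtx u 0 j = 0" and "\<forall>j. mtx (u * a) 0 j = 0"
    then have "P1_class u \<in> P1_le n" "P1_class 0 \<in> P1_le n"
      "P1_act (P1_class u) a = P1_act (P1_class 0) a"
      by (auto simp: P1_class_in_P1_le_iff P1_act_class P1_class_eq_iff)
    then have "P1_class u = P1_class 0"
      using inj by (auto dest: inj_onD)
    then show "mtx u 0 j = 0" by (simp add: P1_class_eq_iff)
  qed
next
  assume R: ?R
  show "inj_on (\<lambda>p. P1_act p a) (P1_le n)"
  proof (rule inj_onI)
    fix p q
    assume "p \<in> P1_le n" "q \<in> P1_le n" and eq: "P1_act p a = P1_act q a"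
    then obtain u v where uv: "p = P1_class u" "q = P1_class v"
      and "\<forall>j>n. mtx u 0 j = 0" "\<forall>j>n. mtx v 0 j = 0"
      unfolding P1_le_eq by blast
    moreover have "\<forall>j. mtx ((u - v) * a) 0 j = 0"
      using eq by (simp add: uv P1_act_class P1_class_eq_iff left_diff_distrib)
    ultimately have "\<forall>j. mtx (u - v) 0 j = 0"
      using R[rule_format, of "u - v"] by simp
    then show "p = q" by (simp add: uv P1_class_eq_iff)
  qed
qed

text \<open>An annihilator on the left of \<open>a\<close> consists of rows each killed by
  \<open>a\<close>, and a single killed row already yields such an annihilator.\<close>

lemma left_regular_iff:
  "a \<in> left_regular_elements \<longleftrightarrow>
     (\<forall>u. (\<forall>j. mtx (u * a) 0 j = 0) \<longrightarrow> (\<forall>j. mtx u 0 j = 0))"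
proof
  assume a: "a \<in> left_regular_elements"
  show "\<forall>u. (\<forall>j. mtx (u * a) 0 j = 0) \<longrightarrow> (\<forall>j. mtx u 0 j = 0)"
  proof (intro allI impI)
    fix u j
    assume "\<forall>j. mtx (u * a) 0 j = 0"
    \<comment> \<open>\<open>opE 0 0\<close> cuts \<open>u\<close> down to its row 0.\<close>
    then have "opE 0 0 * u * a = 0"
      by (auto simp: mtx_inject mult.assoc mtx_opE_left)
    with a have "opE 0 0 * u = 0"
      unfolding left_regular_elements_def by blast
    then have "mtx (opE 0 0 * u) 0 j = 0" by simp
    then show "mtx u 0 j = 0" by (simp add: mtx_opE_left)
  qed
next
  assume *: "\<forall>u. (\<forall>j. mtx (u * a) 0 j = 0) \<longrightarrow> (\<forall>j. mtx u 0 j = 0)"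
  show "a \<in> left_regular_elements"
    unfolding left_regular_elements_def
  proof (intro CollectI allI impI)
    fix r
    assume "r * a = 0"
    \<comment> \<open>Multiplying by \<open>opD ^ i\<close> moves row \<open>i\<close> of
      \<open>r\<close> to row 0.\<close>
    then have "\<forall>j. mtx (opD ^ i * r * a) 0 j = 0" for i
      by (simp add: mult.assoc)
    with * have "mtx (opD ^ i * r) 0 j = 0" for i j by blast
    then show "r = 0" by (simp add: mtx_inject mtx_opD_power_left)
  qed
qed

text \<open>More rows than columns force a linear dependence. The induction eliminates column
  \<open>n\<close> with a pivot row \<open>p\<close>.\<close>

lemma exists_left_kernel:
  fixes M :: "'i \<Rightarrow> nat \<Rightarrow> 'k::field"
  assumes "finite I" "card I > n"
  shows "\<exists>v. (\<exists>i\<in>I. v i \<noteq> 0) \<and> (\<forall>j<n. (\<Sum>i\<in>I. v i * M i j) = 0)"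
  using assms
proof (induction n arbitrary: I M)
  case 0
  then obtain i where "i \<in> I" by fastforce
  then show ?case by (intro exI[of _ "\<lambda>_. 1"]) auto
next
  case (Suc n)
  show ?case
  proof (cases "\<exists>p\<in>I. M p n \<noteq> 0")
    case False
    with Suc.IH[of I M] Suc.prems show ?thesis by (auto simp: less_Suc_eq)
  next
    case True
    then obtain p where p: "p \<in> I" "M p n \<noteq> 0" by blast
    let ?J = "I - {p}"
    have "finite ?J" "n < card ?J"
      using Suc.prems p by simp_all
    then obtain v where v: "\<exists>i\<in>?J. v i \<noteq> 0"
      "\<And>j. j < n \<Longrightarrow> (\<Sum>i\<in>?J. v i * (M i j - M i n / M p n * M p j)) = 0"
      using Suc.IH[of ?J "\<lambda>i j. M i j - M i n / M p n * M p j"] by blast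
    \<comment> \<open>The coefficient of row \<open>p\<close> collects the multiples of the pivot
      row subtracted during elimination.\<close>
    define w where "w = v(p := - (\<Sum>i\<in>?J. v i * (M i n / M p n)))"
    have "(\<Sum>i\<in>I. w i * M i j) = (\<Sum>i\<in>?J. v i * (M i j - M i n / M p n * M p j))" for j
    proof -
      have "(\<Sum>i\<in>I. w i * M i j) = w p * M p j + (\<Sum>i\<in>?J. w i * M i j)"
        using Suc.prems p by (simp add: sum.remove)
      also have "(\<Sum>i\<in>?J. w i * M i j) = (\<Sum>i\<in>?J. v i * M i j)"
        by (intro sum.cong) (auto simp: w_def)
      finally show ?thesis
        by (simp add: w_def right_diff_distrib sum_subtractf sum_distrib_right mult.assoc)
    qed
    moreover have "(\<Sum>i\<in>?J. v i * (M i n - M i n / M p n * M p n)) = 0"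
      using p by simp
    ultimately have "\<forall>j<Suc n. (\<Sum>i\<in>I. w i * M i j) = 0"
      using v(2) by (auto simp: less_Suc_eq)
    moreover have "\<exists>i\<in>I. w i \<noteq> 0"
      using v(1) by (auto simp: w_def)
    ultimately show ?thesis by blast
  qed
qed

text \<open>For large \<open>n\<close>, right multiplication by an element of \<open>\<Psi>\<close> maps rows supported on \<open>{..n}\<close>
  to rows supported on \<open>{..<n}\<close>, so it has a kernel by counting dimensions.\<close>

lemma Psi_not_left_regular:
  assumes "a \<in> Psi"
  shows "a \<notin> left_regular_elements"
proof
  assume reg: "a \<in> left_regular_elements"
  \<comment> \<open>\<open>nu a\<close> bounds \<open>op_size a\<close> even for elements of
    \<open>Psi\<close>, where \<open>mu a\<close> is a mere default value. Rows \<open>0..n\<close>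
    thus have entries only in the \<open>n\<close> columns before \<open>n\<close>.\<close>
  define n where "n = Suc (nu a)"
  have right: "mtx a i j = 0" if "i \<le> n" "j \<ge> n" for i j
  proof -
    have "dcoeff a (- int (j - i)) = 0" using assms by (simp only: Psi_iff)
    then show ?thesis
      using that by (simp add: n_def mtx_above_nu diag_entry_def of_nat_diff)
  qed
  obtain v where v: "\<exists>i\<in>{..n}. v i \<noteq> 0" "\<forall>j<n. (\<Sum>i\<le>n. v i * mtx a i j) = 0"
    using exists_left_kernel[of "{..n}" n "mtx a"] by auto
  define u where "u = (\<Sum>k\<le>n. scl (v k) (opD ^ k))"
  have u: "mtx u 0 j = (if j \<le> n then v j else 0)" for j
    unfolding u_def by (rule mtx_row)
  have "mtx (u * a) 0 j = 0" for j
  proof -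
    have "mtx (u * a) 0 j = (\<Sum>i\<le>n. v i * mtx a i j)"
      by (subst mtx_mult_row[of n]) (auto simp: u intro!: sum.cong)
    also have "\<dots> = 0"
      using v(2) right by (cases "j < n") auto
    finally show ?thesis .
  qed
  with reg have "mtx u 0 j = 0" for j
    unfolding left_regular_iff by blast
  with v(1) show False by (metis atMost_iff u)
qed

lemma left_regular_iff_inj_on:
  fixes a :: "'k::field_char_0 intdiff"
  assumes "a \<notin> Psi"
  shows "a \<in> left_regular_elements \<longleftrightarrow> inj_on (\<lambda>p. P1_act p a) (P1_le (nu a))"
proof -
  let ?n = "deg_D (D_part a)"
  have "mtx u 0 N = 0" if N: "N > nu a" and zero: "\<forall>j. mtx (u * a) 0 j = 0"
    for u :: "'k intdiff" and N
  proof (rule ccontr)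
    assume "mtx u 0 N \<noteq> 0"
    obtain B where B: "\<And>k. k > B \<Longrightarrow> mtx u 0 k = 0"
      using mtx_row_finite by metis
    define S where "S = {k. mtx u 0 k \<noteq> 0}"
    have S: "finite S" "N \<in> S"
      using \<open>mtx u 0 N \<noteq> 0\<close> B finite_nat_set_iff_bounded_le[of S] by (auto simp: S_def not_less[symmetric])
    define L where "L = Max S"
    have L: "L \<in> S" "N \<le> L" and above: "\<And>k. k > L \<Longrightarrow> mtx u 0 k = 0"
      using S Max_in[of S] Max_ge[of S] by (auto simp: L_def S_def not_less[symmetric])
    have "mtx (u * a) 0 (L + ?n) = (\<Sum>k\<le>L. mtx u 0 k * mtx a k (L + ?n))"
      using above by (rule mtx_mult_row)
    \<comment> \<open>For \<open>k < L\<close> the column \<open>L + ?n\<close> lies to the right of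
      the leading diagonal in row \<open>k\<close>.\<close>
    also have "\<dots> = (\<Sum>k\<in>{L}. mtx u 0 k * mtx a k (L + ?n))"
      using N L by (intro sum.mono_neutral_right) (auto intro!: mtx_right_of_leading)
    finally have "mtx u 0 L * mtx a L (L + ?n) = 0"
      using zero by simp
    moreover have "mtx a L (L + ?n) \<noteq> 0"
      using assms N L by (intro mtx_leading) auto
    ultimately show False using L by (simp add: S_def)
  qed
  then show ?thesis
    unfolding left_regular_iff inj_on_P1_act_iff by blast
qed

lemma P1_act_P1_le:
  fixes a :: "'k::field_char_0 intdiff"
  shows "(\<lambda>p. P1_act p a) \<in> P1_le (nu a) \<rightarrow> P1_le (nu a + deg_D (D_part a))"
proof
  fix p :: "'k P1" assume "p \<in> P1_le (nu a)"
  then obtain u where p: "p = P1_class u" and u: "\<And>j. j > nu a \<Longrightarrow> mtx u 0 j = 0"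
    unfolding P1_le_eq by blast
  have "mtx (u * a) 0 j = 0" if "j > nu a + deg_D (D_part a)" for j
  proof -
    have "mtx (u * a) 0 j = (\<Sum>k\<le>nu a. mtx u 0 k * mtx a k j)"
      using u by (rule mtx_mult_row)
    also have "\<dots> = 0"
      using that by (intro sum.neutral) (auto intro!: mtx_right_of_leading)
    finally show ?thesis .
  qed
  then show "P1_act p a \<in> P1_le (nu a + deg_D (D_part a))"
    by (simp add: p P1_act_class P1_class_in_P1_le_iff)
qed


section \<open>The involution is the transposition of matrices\<close>

text \<open>Transposition sends diagonal \<open>k\<close> to \<open>- k\<close> and keeps
  \<open>min i j\<close>, so the transposed matrix again has a symbol.\<close>

lemma exists_transpose: "\<exists>b. \<forall>i j. mtx b i j = mtx a j i"
proof -
  obtain n where fin: "finite {k. dcoeff a k \<noteq> 0}"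
    and n: "\<And>i j. i > n \<or> j > n \<Longrightarrow> mtx a i j = diag_entry (dcoeff a) i j"
    using has_symbol_dcoeff[of a] unfolding has_symbol_def by blast
  have "{k. dcoeff a (- k) \<noteq> 0} = uminus ` {k. dcoeff a k \<noteq> 0}"
    by (force simp: image_iff intro: exI[of _ "- _"])
  with fin have "finite {k. dcoeff a (- k) \<noteq> 0}" by simp
  then show ?thesis
    using n by (intro exists_mtx[of "\<lambda>k. dcoeff a (- k)" n]) (auto simp: diag_entry_def min.commute)
qed

text \<open>As \<open>opX = opI * opH\<close>, the three prescribed values fix the images of all
  generators.\<close>

lemma anti_automorphism_unique:
  assumes "anti_automorphism \<phi>" "\<phi> opD = opI" "\<phi> opI = opD" "\<phi> opH = opH"
    and "anti_automorphism \<psi>" "\<psi> opD = opI" "\<psi> opI = opD" "\<psi> opH = opH"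
  shows "\<phi> = \<psi>"
proof
  fix a
  show "\<phi> a = \<psi> a"
    by (induction a rule: intdiff_induct)
      (use assms in \<open>simp_all add: anti_automorphism_def opX_eq\<close>)
qed

lemma anti_automorphism_transpose:
  fixes \<phi> :: "'k::field_char_0 intdiff \<Rightarrow> 'k intdiff"
  assumes "\<And>a i j. mtx (\<phi> a) i j = mtx a j i"
  shows "anti_automorphism \<phi>"
proof -
  have "\<phi> (\<phi> a) = a" for a
    by (simp add: mtx_inject assms)
  then have "bij \<phi>" by (rule involuntory_imp_bij)
  moreover have "\<phi> (a * b) = \<phi> b * \<phi> a" for a b
  proof -
    have "mtx (\<phi> (a * b)) i j = mtx (\<phi> b * \<phi> a) i j" for i j
    proof -
      obtain N where N: "\<And>k. k > N \<Longrightarrow> mtx b k i = 0"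
        using mtx_column_finite by metis
      then have "mtx (\<phi> (a * b)) i j = (\<Sum>k\<le>N. mtx a j k * mtx b k i)"
        by (simp add: assms mtx_mult_column)
      also have "\<dots> = mtx (\<phi> b * \<phi> a) i j"
        \<comment> \<open>Column \<open>i\<close> of \<open>b\<close> is row \<open>i\<close> of its
          transpose, so the same bound \<open>N\<close> applies.\<close>
        using N by (subst mtx_mult_row[of N]) (simp_all add: assms mult.commute)
      finally show ?thesis .
    qed
    then show ?thesis by (simp add: mtx_inject)
  qed
  ultimately show ?thesis
    unfolding anti_automorphism_def by (auto simp: mtx_inject assms mtx_1)
qed

text \<open>Resolves the definite description: transposition swaps the shifts \<open>opD\<close> and
  \<open>opI\<close>, fixes the diagonal \<open>opH\<close>, and is the only such
  anti-automorphism.\<close>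

lemma mtx_invol: "mtx (invol a) i j = mtx a j i"
  and anti_automorphism_invol: "anti_automorphism invol"
proof -
  obtain \<phi> :: "'k::field_char_0 intdiff \<Rightarrow> 'k intdiff" where \<phi>: "\<And>a i j. mtx (\<phi> a) i j = mtx a j i"
    using exists_transpose by metis
  have D: "mtx (opD :: 'k intdiff) i j = (if j = i + 1 then 1 else 0)" for i j
    using mtx_opD_left[of "1 :: 'k intdiff"] by (auto simp: mtx_1)
  have I: "mtx (opI :: 'k intdiff) i j = (if i = j + 1 then 1 else 0)" for i j
    using mtx_opI_left[of "1 :: 'k intdiff"] by (auto simp: mtx_1 split: nat.splits)
  have H: "mtx (opH :: 'k intdiff) i j = (if i = j then of_nat (i + 1) else 0)" for i j
    using mtx_opH_left[of "1 :: 'k intdiff"] by (simp add: mtx_1)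
  have "anti_automorphism \<phi>" "\<phi> opD = opI" "\<phi> opI = opD" "\<phi> opH = opH"
    using \<phi> by (auto simp: anti_automorphism_transpose mtx_inject D I H)
  then have "invol = \<phi>"
    unfolding invol_def by (intro the_equality) (auto intro!: anti_automorphism_unique)
  then show "mtx (invol a) i j = mtx a j i" "anti_automorphism (invol :: 'k intdiff \<Rightarrow> _)" for a :: "'k intdiff" and i j
    using \<phi> anti_automorphism_transpose by auto
qed

section \<open>Right regular elements via the involution\<close>

lemma invol_invol: "invol (invol a) = a"
  by (simp add: mtx_inject mtx_invol)

lemma invol_mult: "invol (a * b) = invol b * invol a"
  by (metis anti_automorphism_invol anti_automorphism_def)

lemma invol_eq_0_iff: "invol a = 0 \<longleftrightarrow> a = 0"
  by (auto simp: mtx_inject mtx_invol)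

lemma right_regular_iff_invol: "c \<in> right_regular_elements \<longleftrightarrow> invol c \<in> left_regular_elements"
proof -
  have "(\<forall>r. c * r = 0 \<longrightarrow> r = 0) \<longleftrightarrow> (\<forall>r. c * invol r = 0 \<longrightarrow> invol r = 0)"
    by (metis invol_invol)
  also have "\<dots> \<longleftrightarrow> (\<forall>r. r * invol c = 0 \<longrightarrow> r = 0)"
    by (metis invol_eq_0_iff invol_invol invol_mult)
  finally show ?thesis
    unfolding right_regular_elements_def left_regular_elements_def by simp
qed

theorem theorem4p7:
  shows "(left_regular_elements :: 'k::field_char_0 intdiff set) =
      {a. a \<notin> Psi \<and>
          (\<lambda>p. P1_act p a) \<in> P1_le (nu a) \<rightarrow> P1_le (nu a + deg_D (D_part a)) \<and>
          inj_on (\<lambda>p. P1_act p a) (P1_le (nu a))} \<and>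
    (right_regular_elements :: 'k intdiff set) = invol ` left_regular_elements"
proof
  show "(left_regular_elements :: 'k intdiff set) =
      {a. a \<notin> Psi \<and>
          (\<lambda>p. P1_act p a) \<in> P1_le (nu a) \<rightarrow> P1_le (nu a + deg_D (D_part a)) \<and>
          inj_on (\<lambda>p. P1_act p a) (P1_le (nu a))}"
    using Psi_not_left_regular left_regular_iff_inj_on P1_act_P1_le by blast
  show "(right_regular_elements :: 'k intdiff set) = invol ` left_regular_elements"
  proof (intro set_eqI iffI)
    fix c :: "'k intdiff"
    assume "c \<in> right_regular_elements"
    then have "invol c \<in> left_regular_elements" by (simp add: right_regular_iff_invol)
    then show "c \<in> invol ` left_regular_elements" by (rule rev_image_eqI) (simp add: invol_invol)
  qed (auto simp: right_regular_iff_invol invol_invol)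
qed

end
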